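(* Let $\rho_{AB}$ be a two-qubit state with Bloch parameters $(\boldsymbol a,\boldsymbol b,T)$, $\boldsymbol b\ne0$, and $\boldsymbol n_B=\boldsymbol b/|\boldsymbol b|$. For unit $\boldsymbol m\in\mathbb R^3$ put $p(\boldsymbol m)=\tfrac12(1+\boldsymbol a\cdot\boldsymbol m)$, $\boldsymbol r(\boldsymbol m)=(\boldsymbol b+T^T\boldsymbol m)/(1+\boldsymbol a\cdot\boldsymbol m)$, $r_\parallel(\boldsymbol m)=\boldsymbol r(\boldsymbol m)\cdot\boldsymbol n_B$, $r_\perp(\boldsymbol m)=|\boldsymbol r(\boldsymbol m)\times\boldsymbol n_B|$ (terms with $p=0$ are taken to be zero). Let $$\Sigma(r_\parallel,r_\perp)=\frac14\Big[\sqrt{(1+r_\parallel)^2+r_\perp^2}+\sqrt{(1-r_\parallel)^2+r_\perp^2}\Big].$$ Then the dichotomic average steered KD nonclassicality of $\rho_{AB}$ is $$\mathcal C_{KD}^{(2)}(\rho_{AB})=\max_{|\boldsymbol m|=1}\Big[p(\boldsymbol m)\,\Sigma\big(r_\parallel(\boldsymbol m),r_\perp(\boldsymbol m)\big)+p(-\boldsymbol m)\,\Sigma\big(r_\parallel(-\boldsymbol m),r_\perp(-\boldsymbol m)\big)\Big]-\frac12 .$$ Moreover, $\mathcal C_{KD}^{(2)}(\rho_{AB})\le\mathcal C_{KD}(\rho_{AB})$ for every such $\rho_{AB}$.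
   Context: A two-qubit state is written $\rho_{AB}=\tfrac14\big[\mathbb I\otimes\mathbb I+\boldsymbol a\cdot\boldsymbol\sigma\otimes\mathbb I+\mathbb I\otimes\boldsymbol b\cdot\boldsymbol\sigma+\sum_{i,j=1}^3T_{ij}\,\sigma_i\otimes\sigma_j\big]$, with $\boldsymbol a,\boldsymbol b\in\mathbb R^3$ and $T$ a real $3\times3$ matrix; Bob's reduced state is $\rho_B=\tfrac12(\mathbb I+\boldsymbol b\cdot\boldsymbol\sigma)$. Write $\rho(\boldsymbol r)=\tfrac12(\mathbb I+\boldsymbol r\cdot\boldsymbol\sigma)$. KD nonclassicality: the first (reference) basis is the eigenbasis of $\boldsymbol n_B\cdot\boldsymbol\sigma$, with projectors $\Pi_0,\Pi_1$. For an orthonormal qubit basis $\{|b_k\rangle\}_{k=0,1}$ and a qubit state $\rho$, put $Q_{ik}(\rho)=\mathrm{Tr}(|b_k\rangle\langle b_k|\,\Pi_i\,\rho)$, and define $\mathcal N_{KD}(\rho)=\max_{\{|b_k\rangle\}}\tfrac12\big(\sum_{i,k}|Q_{ik}(\rho)|-1\big)$, the maximum over all orthonormal qubit bases with $\boldsymbol n_B$ fixed. Dichotomic average: $\mathcal C_{KD}^{(2)}(\rho_{AB})=\max_{|\boldsymbol m|=1}\big[p(\boldsymbol m)\,\mathcal N_{KD}(\rho(\boldsymbol r(\boldsymbol m)))+p(-\boldsymbol m)\,\mathcal N_{KD}(\rho(\boldsymbol r(-\boldsymbol m)))\big]$, the best average using a two-outcome projective measurement $\{\tfrac12(\mathbb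 I\pm\boldsymbol m\cdot\boldsymbol\sigma)\}$ on Alice's qubit. Full average: $\mathcal C_{KD}(\rho_{AB})=\max_{\{M_a\}}\sum_ap(a)\,\mathcal N_{KD}(\rho_{B|a})$ over all POVMs $\{M_a\}$ on Alice's qubit, where $p(a)=\mathrm{Tr}[(M_a\otimes\mathbb I)\rho_{AB}]$ and $\rho_{B|a}=\mathrm{Tr}_A[(M_a\otimes\mathbb I)\rho_{AB}]/p(a)$ (outcomes with $p(a)=0$ contribute zero). *)

theory Defs
  imports "HOL-Analysis.Analysis"
begin

(* Operators on C^2 are matrices "complex^2^2"; operators on C^2 (x) C^2 are matrices indexed by
   pairs, the first component belonging to Alice and the second to Bob. *)
type_synonym qop = "complex^2^2"
type_synonym qop2 = "complex^(2 \<times> 2)^(2 \<times> 2)"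

(* The value of a maximum.  It is unspecified when the maximum is not attained, so every statement
   about a concrete value of it involves attainment; it is not a supremum. *)
definition max_over :: "('a \<Rightarrow> real) \<Rightarrow> 'a set \<Rightarrow> real" where
  "max_over f S = (GREATEST v. v \<in> f ` S)"

(* The real inner product of HOL-Analysis on complex^'n is the real part of this one. *)
definition cinner :: "complex^'n::finite \<Rightarrow> complex^'n \<Rightarrow> complex" where
  "cinner u v = (\<Sum>i\<in>UNIV. cnj (u $ i) * v $ i)"

definition psd :: "complex^'n::finite^'n \<Rightarrow> bool" where
  "psd A \<longleftrightarrow> (\<forall>v. cinner v (A *v v) \<in> \<real>\<^sub>\<ge>\<^sub>0)"

definition density_op :: "complex^'n::finite^'n \<Rightarrow> bool" where
  "density_op \<rho> \<longleftrightarrow> psd \<rho> \<and> trace \<rho> = 1"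

definition ketbra :: "complex^'n::finite \<Rightarrow> complex^'n^'n" where
  "ketbra v = (\<chi> i j. v $ i * cnj (v $ j))"

definition tensor :: "qop \<Rightarrow> qop \<Rightarrow> qop2" where
  "tensor A B = (\<chi> r c. A $ fst r $ fst c * B $ snd r $ snd c)"

definition ptrace_A :: "qop2 \<Rightarrow> qop" where
  "ptrace_A X = (\<chi> k l. \<Sum>i\<in>UNIV. X $ (i, k) $ (i, l))"

definition pauli :: "qop^3" where
  "pauli = vector [vector [vector [0, 1], vector [1, 0]],
                   vector [vector [0, - \<i>], vector [\<i>, 0]],
                   vector [vector [1, 0], vector [0, -1]]]"

definition bloch_op :: "real^3 \<Rightarrow> qop" where
  "bloch_op v = (\<Sum>i\<in>UNIV. (v $ i) *\<^sub>R (pauli $ i))"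

definition qubit_state :: "real^3 \<Rightarrow> qop" where
  "qubit_state r = (1/2) *\<^sub>R (mat 1 + bloch_op r)"

definition two_qubit :: "real^3 \<Rightarrow> real^3 \<Rightarrow> real^3^3 \<Rightarrow> qop2" where
  "two_qubit a b T = (1/4) *\<^sub>R
     (tensor (mat 1) (mat 1) + tensor (bloch_op a) (mat 1) + tensor (mat 1) (bloch_op b)
      + (\<Sum>i\<in>UNIV. \<Sum>j\<in>UNIV. (T $ i $ j) *\<^sub>R tensor (pauli $ i) (pauli $ j)))"

(* For a unit vector n, the projector onto the eigenspace of bloch_op n for the eigenvalue
   1 (i = 0) or -1 (i = 1); see eig_proj_eigen and eig_proj_complete below. *)
definition eig_proj :: "real^3 \<Rightarrow> nat \<Rightarrow> qop" where
  "eig_proj n i = (1/2) *\<^sub>R (mat 1 + ((-1) ^ i) *\<^sub>R bloch_op n)"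

(* Only the values at 0 and 1 matter. *)
definition qubit_basis :: "(nat \<Rightarrow> complex^2) \<Rightarrow> bool" where
  "qubit_basis e \<longleftrightarrow> (\<forall>j<2. \<forall>k<2. cinner (e j) (e k) = (if j = k then 1 else 0))"

definition KD :: "real^3 \<Rightarrow> (nat \<Rightarrow> complex^2) \<Rightarrow> qop \<Rightarrow> nat \<Rightarrow> nat \<Rightarrow> complex" where
  "KD n e \<rho> i k = trace (ketbra (e k) ** eig_proj n i ** \<rho>)"

definition N_KD :: "real^3 \<Rightarrow> qop \<Rightarrow> real" where
  "N_KD n \<rho> =
     max_over (\<lambda>e. 1/2 * ((\<Sum>i<2. \<Sum>k<2. cmod (KD n e \<rho> i k)) - 1)) {e. qubit_basis e}"

definition steer_prob :: "real^3 \<Rightarrow> real^3 \<Rightarrow> real" where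
  "steer_prob a m = 1/2 * (1 + a \<bullet> m)"

(* Where 1 + a \<bullet> m = 0 this is the zero vector, but it is then always weighted by
   steer_prob a m = 0. *)
definition steer_bloch :: "real^3 \<Rightarrow> real^3 \<Rightarrow> real^3^3 \<Rightarrow> real^3 \<Rightarrow> real^3" where
  "steer_bloch a b T m = (1 / (1 + a \<bullet> m)) *\<^sub>R (b + transpose T *v m)"

definition C_KD2 :: "real^3 \<Rightarrow> real^3 \<Rightarrow> real^3 \<Rightarrow> real^3^3 \<Rightarrow> real" where
  "C_KD2 n a b T =
     max_over (\<lambda>m. steer_prob a m * N_KD n (qubit_state (steer_bloch a b T m))
                 + steer_prob a (- m) * N_KD n (qubit_state (steer_bloch a b T (- m))))
              {m. norm m = 1}"

definition povm :: "qop list \<Rightarrow> bool" where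
  "povm Ms \<longleftrightarrow> (\<forall>M\<in>set Ms. psd M) \<and> sum_list Ms = mat 1"

definition outcome_prob :: "qop2 \<Rightarrow> qop \<Rightarrow> real" where
  "outcome_prob \<rho> M = Re (trace (tensor M (mat 1) ** \<rho>))"

definition cond_state :: "qop2 \<Rightarrow> qop \<Rightarrow> qop" where
  "cond_state \<rho> M = (1 / outcome_prob \<rho> M) *\<^sub>R ptrace_A (tensor M (mat 1) ** \<rho>)"

definition C_KD :: "real^3 \<Rightarrow> qop2 \<Rightarrow> real" where
  "C_KD n \<rho> =
     max_over (\<lambda>Ms. \<Sum>M\<leftarrow>Ms. outcome_prob \<rho> M * N_KD n (cond_state \<rho> M)) {Ms. povm Ms}"

definition Sigma_KD :: "real \<Rightarrow> real \<Rightarrow> real" where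
  "Sigma_KD x y = 1/4 * (sqrt ((1 + x)\<^sup>2 + y\<^sup>2) + sqrt ((1 - x)\<^sup>2 + y\<^sup>2))"

definition r_par :: "real^3 \<Rightarrow> real^3 \<Rightarrow> real" where
  "r_par n r = r \<bullet> n"

definition r_perp :: "real^3 \<Rightarrow> real^3 \<Rightarrow> real" where
  "r_perp n r = norm (cross3 r n)"


lemma matrix_mult_scaleR_right: "(A :: qop) ** (c *\<^sub>R B) = c *\<^sub>R (A ** B)"
  by (simp add: vec_eq_iff matrix_matrix_mult_def sum_2 scaleR_right_distrib)

lemma bloch_op_sq:
  assumes "norm n = 1"
  shows "bloch_op n ** bloch_op n = mat 1"
proof -
  have "n \<bullet> n = 1"
    using assms by (simp add: norm_eq_1)
  then have n: "n $ 1 * n $ 1 + n $ 2 * n $ 2 + n $ 3 * n $ 3 = 1"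
    by (simp add: inner_vec_def sum_3)
  show ?thesis
    using n
    by (simp add: vec_eq_iff forall_2 matrix_matrix_mult_def sum_2 bloch_op_def sum_3 pauli_def
        mat_def complex_eq_iff algebra_simps)
qed

lemma eig_proj_complete: "eig_proj n 0 + eig_proj n 1 = mat 1"
proof -
  have "eig_proj n 0 + eig_proj n 1 = (1/2) *\<^sub>R (mat 1 + mat 1)"
    unfolding eig_proj_def scaleR_right_distrib[symmetric] by simp
  also have "\<dots> = mat 1"
    by (simp add: scaleR_2[symmetric])
  finally show ?thesis .
qed

lemma eig_proj_eigen:
  assumes "norm n = 1"
  shows "bloch_op n ** eig_proj n i = ((-1) ^ i) *\<^sub>R eig_proj n i"
proof -
  have "(-1 :: real) ^ i * (-1) ^ i = 1"
    by (simp add: power_mult_distrib[symmetric])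
  then show ?thesis
    by (simp add: eig_proj_def matrix_mult_scaleR_right matrix_add_ldistrib bloch_op_sq[OF assms]
        scaleR_add_right add.commute)
qed

lemma ptrace_A_two_qubit: "ptrace_A (two_qubit a b T) = qubit_state b"
  by (simp add: vec_eq_iff forall_2 ptrace_A_def two_qubit_def qubit_state_def tensor_def
      bloch_op_def pauli_def mat_def sum_2 sum_3 complex_eq_iff field_simps)

end

theory Submission
  imports Defs
begin

text \<open>For a fixed reference vector, Cauchy--Schwarz bounds the Kirkwood--Dirac row sum by half the
  norm of the sum of its Bloch vector and that of the state, with equality for every basis whose
  Bloch vector is orthogonal to both. Hence \<open>N_KD = Sigma - 1/2\<close>, and the constant drops out of the
  average because the two probabilities add up to 1.

  Weighted by its probability, the contribution of an effect on Alice's side is a continuous,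
  positively homogeneous function of the effect; positivity of the state excludes a jump where the
  probability vanishes. So the dichotomic maximum is attained on the sphere. The maximum over POVMs
  with any number of outcomes is attained as well: up to normalisation, the POVM averages are the
  points of the graph's (compact) convex hull lying over the centre of the Bloch ball. A dichotomic
  measurement is a POVM, which gives the inequality.\<close>

text \<open>\<open>GREATEST\<close> has a known value only where a maximiser is exhibited, so every
  maximum below is evaluated by producing a point that attains it.\<close>

lemma max_over_eq:
  assumes "x \<in> S" "\<And>y. y \<in> S \<Longrightarrow> f y \<le> f x"
  shows "max_over f S = f x"
  unfolding max_over_def by (rule Greatest_equality) (use assms in auto)

section \<open>Bloch vectors of pure states and of qubit bases\<close>

text \<open>The vector of Pauli expectations of \<open>v\<close>, that is, the Hopf map. It is left
  unnormalised, so it is quadratic in \<open>v\<close> and its length is the squared norm of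
  \<open>v\<close>.\<close>

definition bloch_of :: "complex^2 \<Rightarrow> real^3" where
  "bloch_of v = vector [2 * Re (cnj (v $ 1) * v $ 2), 2 * Im (cnj (v $ 1) * v $ 2),
                        Re (cnj (v $ 1) * v $ 1) - Re (cnj (v $ 2) * v $ 2)]"

lemma cinner_self: "cinner v v = of_real ((norm v)\<^sup>2)"
  by (simp add: cinner_def norm_vec_def L2_set_def sum_nonneg)
     (metis (no_types, lifting) complex_norm_square mult.commute of_real_power sum.cong)

lemma norm_sq_complex2:
  "(norm (v :: complex^2))\<^sup>2 =
    Re (v $ 1) * Re (v $ 1) + Im (v $ 1) * Im (v $ 1) + Re (v $ 2) * Re (v $ 2) + Im (v $ 2) * Im (v $ 2)"
  by (simp add: norm_vec_def L2_set_def sum_2 cmod_power2) (simp add: power2_eq_square)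

text \<open>Homogeneous form of the rule that the transition probability between unit vectors is
  half of one plus the inner product of their Bloch vectors. Taking \<open>u = v\<close> gives the
  length; orthogonal unit vectors have antipodal images.\<close>

lemma inner_bloch_of:
  "bloch_of u \<bullet> bloch_of v = 2 * (cmod (cinner u v))\<^sup>2 - (norm u)\<^sup>2 * (norm v)\<^sup>2"
  unfolding cmod_power2 norm_sq_complex2
  by (simp add: bloch_of_def inner_vec_def sum_3 sum_2 cinner_def power2_eq_square algebra_simps)

lemma norm_bloch_of: "norm (bloch_of v) = (norm v)\<^sup>2"
proof -
  have "(norm (bloch_of v))\<^sup>2 = ((norm v)\<^sup>2)\<^sup>2"
    unfolding power2_norm_eq_inner inner_bloch_of cinner_self norm_of_real
    by (simp add: power2_eq_square)
  then show ?thesis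
    by (rule power2_eq_imp_eq) simp_all
qed

lemma ketbra_eq: "norm v = 1 \<Longrightarrow> ketbra v = qubit_state (bloch_of v)"
  using norm_sq_complex2[of v]
  by (simp add: vec_eq_iff forall_2 ketbra_def qubit_state_def bloch_op_def sum_3 pauli_def
        mat_def bloch_of_def complex_eq_iff field_simps)

lemma cinner_bloch_op: "cinner v (bloch_op x *v v) = of_real (x \<bullet> bloch_of v)"
  by (simp add: cinner_def bloch_op_def sum_3 sum_2 pauli_def matrix_vector_mult_def bloch_of_def
      inner_vec_def complex_eq_iff algebra_simps)

text \<open>A preimage can be chosen with a real positive first coordinate, except at the south
  pole, where that coordinate vanishes. That the preimage is a unit vector then follows from
  \<open>norm_bloch_of\<close>.\<close>

lemma bloch_of_surj:
  assumes "norm s = 1"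
  obtains v where "norm v = 1" "bloch_of v = s"
proof -
  have s: "s$1 * s$1 + s$2 * s$2 + s$3 * s$3 = 1"
    using assms by (simp add: norm_eq_1 inner_vec_def sum_3)
  have "\<exists>v. bloch_of v = s"
  proof (cases "1 + s$3 = 0")
    case True
    then have "s$3 = -1" by simp
    moreover from this s have "s$1 * s$1 + s$2 * s$2 = 0" by simp
    then have "s$1 = 0" "s$2 = 0" by (auto simp: sum_squares_eq_zero_iff)
    ultimately have "bloch_of (vector [0, 1]) = s"
      by (simp add: bloch_of_def vec_eq_iff forall_3)
    then show ?thesis by blast
  next
    case False
    have "s$3 * s$3 \<le> 1" using s by (smt (verit) zero_le_square)
    then have "\<bar>s$3\<bar> \<le> 1" by (simp add: power2_eq_square flip: abs_square_le_1)
    with False have pos: "1 + s$3 > 0" by linarith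
    \<comment> \<open>For a unit vector over \<open>s\<close>, the first coordinate has squared
      modulus \<open>(1 + s$3) / 2\<close>; the first two components of \<open>s\<close> then
      determine the second coordinate.\<close>
    define c where "c = sqrt ((1 + s$3) / 2)"
    have c: "c > 0" "c*c = (1 + s$3)/2" using pos by (auto simp: c_def)
    define p q where "p = s$1 / (2*c)" and "q = s$2 / (2*c)"
    have pq: "s$1 = 2*c*p" "s$2 = 2*c*q" using c(1) by (simp_all add: p_def q_def)
    have "s$1 * s$1 + s$2 * s$2 = 4 * (c*c) * (p*p + q*q)"
      by (simp add: pq algebra_simps)
    then have "(1 + s$3) * (2 * (p*p + q*q)) = (1 + s$3) * (1 - s$3)"
      using s by (simp add: c(2) algebra_simps)
    then have e: "2 * (p*p + q*q) = 1 - s$3" using pos by simp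
    have "bloch_of (vector [of_real c, Complex p q]) = s"
      using e by (simp add: bloch_of_def vec_eq_iff forall_3 pq c(2) field_simps)
    then show ?thesis by blast
  qed
  then obtain v where v: "bloch_of v = s" by blast
  then have "(norm v)\<^sup>2 = 1" using norm_bloch_of[of v] assms by simp
  then have "norm v = 1" by (simp add: power2_eq_1_iff) (smt (verit) norm_ge_zero)
  with v show ?thesis using that by blast
qed

lemma cinner_commute: "cinner u w = cnj (cinner w u)"
  by (simp add: cinner_def mult.commute)

lemma qubit_basisD:
  assumes "qubit_basis e"
  shows "norm (e 0) = 1" "norm (e 1) = 1" "bloch_of (e 1) = - bloch_of (e 0)"
proof -
  have c: "cinner (e 0) (e 0) = 1" "cinner (e 1) (e 1) = 1" "cinner (e 0) (e 1) = 0"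
    using assms by (auto simp: qubit_basis_def)
  have "(norm (e 0))\<^sup>2 = 1" "(norm (e 1))\<^sup>2 = 1"
    using c(1,2) unfolding cinner_self by (metis of_real_eq_1_iff)+
  then show n: "norm (e 0) = 1" "norm (e 1) = 1"
    by (smt (verit) norm_ge_zero power2_eq_1_iff)+
  have "bloch_of (e 0) \<bullet> bloch_of (e 1) = -1"
    using c(3) n by (simp only: inner_bloch_of) simp
  \<comment> \<open>Equality case of Cauchy-Schwarz: unit vectors with inner product -1 are
    opposite.\<close>
  then have "(norm (bloch_of (e 1) + bloch_of (e 0)))\<^sup>2 = 0"
    using n by (simp add: power2_norm_eq_inner inner_add inner_commute)
       (simp add: dot_square_norm norm_bloch_of)
  then show "bloch_of (e 1) = - bloch_of (e 0)"
    by (simp add: eq_neg_iff_add_eq_0)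
qed

lemma qubit_basis_exists:
  assumes "norm s = 1"
  obtains e where "qubit_basis e" "bloch_of (e 0) = s"
proof -
  obtain u v where u: "norm u = 1" "bloch_of u = s" and v: "norm v = 1" "bloch_of v = - s"
    using bloch_of_surj[of s] bloch_of_surj[of "- s"] assms by (metis norm_minus_cancel)
  have "cinner u v = 0"
    using inner_bloch_of[of u v] assms u v by (simp add: norm_eq_1)
  moreover from this have "cinner v u = 0"
    by (metis cinner_commute complex_cnj_zero)
  ultimately have "qubit_basis (\<lambda>k. if k = 0 then u else v)"
    using u v by (auto simp: qubit_basis_def cinner_self less_2_cases_iff)
  then show ?thesis using that[of "\<lambda>k. if k = 0 then u else v"] u by simp
qed

section \<open>Kirkwood-Dirac entries and the closed form of the nonclassicality\<close>

lemma trace_qubit_states: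
  "trace (qubit_state s ** qubit_state n ** qubit_state r) =
     Complex ((1 + s \<bullet> n + n \<bullet> r + s \<bullet> r) / 4) (s \<bullet> cross3 n r / 4)"
  by (simp add: trace_def qubit_state_def bloch_op_def pauli_def mat_def matrix_matrix_mult_def
      sum_2 sum_3 inner_vec_def cross3_def complex_eq_iff field_simps)

text \<open>The square of the triple product is the Gram determinant. This removes the cross product
  from the squared modulus of an entry and leaves inner products only.\<close>

lemma gram_det:
  fixes s n r :: "real^3"
  shows "(s \<bullet> cross3 n r)\<^sup>2 =
    (s \<bullet> s) * (n \<bullet> n) * (r \<bullet> r) + 2 * (s \<bullet> n) * (n \<bullet> r) * (s \<bullet> r)
     - (s \<bullet> n)\<^sup>2 * (r \<bullet> r) - (n \<bullet> r)\<^sup>2 * (s \<bullet> s) - (s \<bullet> r)\<^sup>2 * (n \<bullet> n)"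
  by (simp add: inner_vec_def sum_3 cross3_def power2_eq_square algebra_simps)

lemma eig_proj_eq: "eig_proj n i = qubit_state ((-1) ^ i *\<^sub>R n)"
  by (simp add: eig_proj_def qubit_state_def bloch_op_def scaleR_sum_right)

text \<open>An entry is a product of two amplitudes, so its squared modulus factors. Half of
  \<open>1 + s \<bullet> m\<close> is the overlap of the basis vector with the eigenvector of Bloch
  vector \<open>m\<close>; the other factor is, up to a constant, the squared matrix element of the
  state between these two vectors.\<close>

lemma cmod_KD:
  fixes n :: "real^3" and e :: "nat \<Rightarrow> complex^2" and i k :: nat
  assumes "norm n = 1" "norm (e k) = 1"
  defines "s \<equiv> bloch_of (e k)" and "m \<equiv> (-1) ^ i *\<^sub>R n"
  shows "(cmod (KD n e (qubit_state r) i k))\<^sup>2 =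
    (1 + s \<bullet> m) *
      ((norm (m + r))\<^sup>2 + 2 * (s \<bullet> r) * (1 + m \<bullet> r) + (s \<bullet> m) * (1 - r \<bullet> r)) / 16"
proof -
  have "norm m = 1" "norm s = 1"
    using assms by (simp_all add: norm_bloch_of)
  then have 1: "m \<bullet> m = 1" "s \<bullet> s = 1"
    by (simp_all add: norm_eq_1)
  have "KD n e (qubit_state r) i k =
      Complex ((1 + s \<bullet> m + m \<bullet> r + s \<bullet> r) / 4) (s \<bullet> cross3 m r / 4)"
    using assms by (simp add: KD_def ketbra_eq eig_proj_eq trace_qubit_states)
  then have "(cmod (KD n e (qubit_state r) i k))\<^sup>2 =
      ((1 + s \<bullet> m + m \<bullet> r + s \<bullet> r)\<^sup>2 + (s \<bullet> cross3 m r)\<^sup>2) / 16"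
    by (simp add: cmod_power2 power_divide)
  also have "(1 + s \<bullet> m + m \<bullet> r + s \<bullet> r)\<^sup>2 + (s \<bullet> cross3 m r)\<^sup>2 =
      (1 + s \<bullet> m) *
      ((norm (m + r))\<^sup>2 + 2 * (s \<bullet> r) * (1 + m \<bullet> r) + (s \<bullet> m) * (1 - r \<bullet> r))"
    unfolding gram_det 1 power2_norm_eq_inner
    by (simp add: 1 inner_add inner_commute power2_eq_square algebra_simps)
  finally show ?thesis .
qed

text \<open>Cauchy--Schwarz over the two basis vectors, whose overlaps with the reference vector have
  squares summing to 1. Equality holds for a basis unbiased to the reference one whose Bloch vector
  is also orthogonal to that of the state, see \<open>KD_row_unbiased\<close> below.\<close>

lemma KD_row_le:
  assumes n: "norm n = 1" and e: "qubit_basis e"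
  shows "(\<Sum>k<2. cmod (KD n e (qubit_state r) i k)) \<le> norm ((-1) ^ i *\<^sub>R n + r) / 2"
proof -
  define m where "m = (-1) ^ i *\<^sub>R n"
  define s where "s = bloch_of (e 0)"
  define A where "A k = cmod (KD n e (qubit_state r) i k)" for k
  define N where "N = norm (m + r)"
  define c where "c = s \<bullet> m"
  define d where "d = 2 * (s \<bullet> r) * (1 + m \<bullet> r) + c * (1 - r \<bullet> r)"
  note b = qubit_basisD[OF e]
  have A0: "(A 0)\<^sup>2 = (1 + c) * (N\<^sup>2 + d) / 16"
    using cmod_KD[of n e 0 r i] n b(1) by (simp add: A_def m_def s_def N_def c_def d_def algebra_simps)
  \<comment> \<open>Passing to the other basis vector replaces \<open>s\<close> by
    \<open>- s\<close>, which flips the signs of both \<open>c\<close> and \<open>d\<close>.\<close>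
  have A1: "(A 1)\<^sup>2 = (1 - c) * (N\<^sup>2 - d) / 16"
    using cmod_KD[of n e 1 r i] n b(2) unfolding b(3)
    by (simp add: A_def m_def s_def N_def c_def d_def algebra_simps)
  have "norm m = 1" "norm s = 1"
    using n b by (simp_all add: norm_bloch_of m_def s_def)
  then have c: "\<bar>c\<bar> \<le> 1"
    using Cauchy_Schwarz_ineq2[of s m] by (simp add: c_def)
  have nn: "A k \<ge> 0" "N \<ge> 0" for k
    by (simp_all add: A_def N_def)
  \<comment> \<open>With P the projector of Bloch vector \<open>m\<close>, the operator 8 rho P rho
    has the scalar part \<open>N\<^sup>2\<close> and the Pauli vector \<open>w\<close>. It has rank
    at most one, which is why the length of \<open>w\<close> is exactly
    \<open>N\<^sup>2\<close>.\<close>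
  have d: "\<bar>d\<bar> \<le> N\<^sup>2"
  proof -
    define w where "w = (2 * (1 + m \<bullet> r)) *\<^sub>R r + (1 - r \<bullet> r) *\<^sub>R m"
    have "(norm w)\<^sup>2 = (N\<^sup>2)\<^sup>2"
      using \<open>norm m = 1\<close> unfolding N_def power2_norm_eq_inner
      by (simp add: w_def inner_add inner_commute norm_eq_1 power2_eq_square algebra_simps)
    then have "norm w = N\<^sup>2"
      by (rule power2_eq_imp_eq) simp_all
    moreover have "d = s \<bullet> w"
      by (simp add: d_def w_def c_def inner_add_right algebra_simps)
    ultimately show ?thesis
      using Cauchy_Schwarz_ineq2[of s w] \<open>norm s = 1\<close> by simp
  qed
  have "\<bar>c * d\<bar> \<le> 1 * N\<^sup>2"
    unfolding abs_mult using c d by (intro mult_mono) auto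
  then have cd: "0 \<le> N\<^sup>2 - c * d"
    by linarith
  \<comment> \<open>Cauchy-Schwarz with explicit remainder: the discarded square
    \<open>(c * N\<^sup>2 - d)\<^sup>2\<close> measures the distance from equality.\<close>
  have "(16 * (A 0 * A 1))\<^sup>2 = 16 * (A 0)\<^sup>2 * (16 * (A 1)\<^sup>2)"
    by (simp add: power_mult_distrib)
  also have "\<dots> = (N\<^sup>2 - c * d)\<^sup>2 - (c * N\<^sup>2 - d)\<^sup>2"
    unfolding A0 A1 by (simp add: power2_eq_square field_simps)
  also have "\<dots> \<le> (N\<^sup>2 - c * d)\<^sup>2"
    by simp
  finally have prod: "16 * (A 0 * A 1) \<le> N\<^sup>2 - c * d"
    using cd by (rule power2_le_imp_le)
  have squares: "(A 0)\<^sup>2 + (A 1)\<^sup>2 = (N\<^sup>2 + c * d) / 8"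
    unfolding A0 A1 by (simp add: algebra_simps add_divide_distrib[symmetric])
  \<comment> \<open>The terms in \<open>c * d\<close> from the squares and from the mixed product
    cancel, so the bound no longer depends on the basis.\<close>
  have "(A 0 + A 1)\<^sup>2 = ((A 0)\<^sup>2 + (A 1)\<^sup>2) + 16 * (A 0 * A 1) / 8"
    by (simp add: power2_sum)
  also have "\<dots> \<le> (N\<^sup>2 + c * d) / 8 + (N\<^sup>2 - c * d) / 8"
    unfolding squares using prod by (intro add_mono divide_right_mono) simp_all
  also have "\<dots> = (N / 2)\<^sup>2"
    by (simp add: power_divide add_divide_distrib diff_divide_distrib)
  finally have "(A 0 + A 1)\<^sup>2 \<le> (N / 2)\<^sup>2" .
  then have "A 0 + A 1 \<le> N / 2"
    by (rule power2_le_imp_le) (use nn(2) in simp)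
  then show ?thesis
    by (simp add: A_def N_def m_def lessThan_Suc numeral_2_eq_2)
qed

lemma KD_row_unbiased:
  assumes n: "norm n = 1" and e: "qubit_basis e"
    and orth: "bloch_of (e 0) \<bullet> n = 0" "bloch_of (e 0) \<bullet> r = 0"
  shows "(\<Sum>k<2. cmod (KD n e (qubit_state r) i k)) = norm ((-1) ^ i *\<^sub>R n + r) / 2"
proof -
  note b = qubit_basisD[OF e]
  have "cmod (KD n e (qubit_state r) i k) = norm ((-1) ^ i *\<^sub>R n + r) / 4" if "k < 2" for k
  proof (rule power2_eq_imp_eq)
    have k: "norm (e k) = 1" "bloch_of (e k) \<bullet> n = 0" "bloch_of (e k) \<bullet> r = 0"
      using that b orth by (auto simp: less_2_cases_iff)
    show "(cmod (KD n e (qubit_state r) i k))\<^sup>2 = (norm ((-1) ^ i *\<^sub>R n + r) / 4)\<^sup>2"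
      by (simp add: cmod_KD[of n e k, OF n k(1)] k power_divide)
  qed simp_all
  then have "(\<Sum>k<2. cmod (KD n e (qubit_state r) i k)) =
      (\<Sum>k<(2::nat). norm ((-1) ^ i *\<^sub>R n + r) / 4)"
    by (intro sum.cong) auto
  then show ?thesis
    by simp
qed

text \<open>Pythagoras along and across \<open>n\<close>. The two signs turn the two row bounds into
  the two square roots of \<open>Sigma_KD\<close>.\<close>

lemma norm_reference_add:
  assumes n: "norm n = 1"
  shows "norm ((-1) ^ i *\<^sub>R n + r) = sqrt ((1 + (-1) ^ i * r_par n r)\<^sup>2 + (r_perp n r)\<^sup>2)"
proof -
  have 1: "n \<bullet> n = 1" using n by (simp add: norm_eq_1)
  have sq: "((-1 :: real) ^ i)\<^sup>2 = 1"
    by (simp add: power2_eq_square power_mult_distrib[symmetric])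
  define z :: real where "z = (-1) ^ i"
  have "(norm (z *\<^sub>R n + r))\<^sup>2 = z\<^sup>2 + 2 * (z * (n \<bullet> r)) + (norm r)\<^sup>2"
    using 1 unfolding power2_norm_eq_inner
    by (simp add: inner_add_left inner_add_right inner_commute[of r n] power2_eq_square distrib_left)
  also have "(norm r)\<^sup>2 = (norm (cross3 r n))\<^sup>2 + (n \<bullet> r)\<^sup>2"
    using norm_cross_dot[of r n] n by (simp add: inner_commute[of r n])
  also have "z\<^sup>2 + 2 * (z * (n \<bullet> r)) + ((norm (cross3 r n))\<^sup>2 + (n \<bullet> r)\<^sup>2) =
      (1 + z * r_par n r)\<^sup>2 + (r_perp n r)\<^sup>2"
    using sq[folded z_def] unfolding r_par_def r_perp_def inner_commute[of r n]
    by (simp add: power2_sum power_mult_distrib)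
  finally have "(norm ((-1) ^ i *\<^sub>R n + r))\<^sup>2 =
      (1 + (-1) ^ i * r_par n r)\<^sup>2 + (r_perp n r)\<^sup>2"
    unfolding z_def .
  then show ?thesis
    by (rule real_sqrt_unique[OF _ norm_ge_zero, symmetric])
qed

text \<open>A dimension count rather than the normalised cross product, because \<open>n\<close> and
  \<open>r\<close> may be parallel.\<close>

lemma unit_orthogonal_exists:
  fixes n r :: "real^3"
  obtains s where "norm s = 1" "s \<bullet> n = 0" "s \<bullet> r = 0"
proof -
  have "dim {n, r} \<le> card {n, r}"
    by (rule dim_le_card') simp
  also have "\<dots> < DIM(real^3)"
    by (rule le_less_trans[OF card_insert_le_m1[of 2]]) simp_all
  finally have "dim {n, r} < DIM(real^3)" .
  then obtain x where x: "x \<noteq> 0" "\<And>y. y \<in> span {n, r} \<Longrightarrow> orthogonal x y"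
    using orthogonal_to_subspace_exists[of "{n, r}"] by blast
  then have "x \<bullet> n = 0" "x \<bullet> r = 0"
    by (simp_all add: orthogonal_def span_base)
  with x(1) that[of "x /\<^sub>R norm x"] show ?thesis
    by simp
qed

text \<open>A basis whose Bloch vector is orthogonal to \<open>n\<close> and \<open>r\<close>
  attains both row bounds at once, so the maximum is the sum of the separate row maxima.\<close>

theorem N_KD_qubit_state:
  assumes n: "norm n = 1"
  shows "N_KD n (qubit_state r) = Sigma_KD (r_par n r) (r_perp n r) - 1/2"
proof -
  define f where "f e = 1/2 * ((\<Sum>i<2. \<Sum>k<2. cmod (KD n e (qubit_state r) i k)) - 1)" for e
  define B where "B = 1/2 * ((\<Sum>i<2::nat. norm ((-1) ^ i *\<^sub>R n + r) / 2) - 1)"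
  obtain s where s: "norm s = 1" "s \<bullet> n = 0" "s \<bullet> r = 0"
    using unit_orthogonal_exists .
  obtain e where e: "qubit_basis e" "bloch_of (e 0) = s"
    using qubit_basis_exists[OF s(1)] .
  have "f e = B"
    unfolding f_def B_def using s e(2) by (simp only: KD_row_unbiased[OF n e(1)])
  moreover have "f e' \<le> B" if "qubit_basis e'" for e'
    unfolding f_def B_def
    by (intro mult_left_mono diff_right_mono sum_mono KD_row_le[OF n that]) simp
  moreover have "N_KD n (qubit_state r) = max_over f {e. qubit_basis e}"
    unfolding N_KD_def f_def ..
  ultimately have "N_KD n (qubit_state r) = B"
    using max_over_eq[of e "{e. qubit_basis e}" f] e(1) by (metis mem_Collect_eq)
  moreover have "B = Sigma_KD (r_par n r) (r_perp n r) - 1/2"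
    unfolding B_def norm_reference_add[OF n]
    by (simp add: Sigma_KD_def numeral_2_eq_2 lessThan_Suc)
  ultimately show ?thesis
    by simp
qed

section \<open>Effects and unnormalised states in Bloch coordinates\<close>

text \<open>Coordinates for Hermitian operators in which \<open>w\<close> is the trace and
  positivity becomes the cone \<open>norm y \<le> w\<close>. The effect of a projective measurement
  along a unit vector \<open>m\<close> is \<open>herm 1 m\<close>.\<close>

definition herm :: "real \<Rightarrow> real^3 \<Rightarrow> qop" where
  "herm w y = (1/2) *\<^sub>R (w *\<^sub>R mat 1 + bloch_op y)"

lemma qubit_state_herm: "qubit_state x = herm 1 x"
  by (simp add: qubit_state_def herm_def)

lemma bloch_op_add: "bloch_op (x + y) = bloch_op x + bloch_op y"
  by (simp add: bloch_op_def scaleR_add_left sum.distrib)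

lemma bloch_op_scaleR: "bloch_op (c *\<^sub>R x) = c *\<^sub>R bloch_op x"
  by (simp add: bloch_op_def scaleR_sum_right)

lemma herm_add: "herm w x + herm v y = herm (w + v) (x + y)"
  by (simp add: herm_def bloch_op_def scaleR_add_left scaleR_add_right sum.distrib add_ac)

lemma herm_scaleR: "c *\<^sub>R herm w y = herm (c * w) (c *\<^sub>R y)"
  by (simp add: herm_def bloch_op_def scaleR_add_right scaleR_sum_right mult.assoc mult.left_commute)

lemma herm_0: "herm 0 0 = 0"
  by (simp add: herm_def bloch_op_def)

lemma herm_2: "herm 2 0 = mat 1"
  by (simp add: herm_def bloch_op_def)

lemma herm_sum: "(\<Sum>i\<in>I. herm (w i) (y i)) = herm (\<Sum>i\<in>I. w i) (\<Sum>i\<in>I. y i)"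
  by (induction I rule: infinite_finite_induct) (simp_all add: herm_0 herm_add)

lemma herm_entries:
  "herm w y $ 1 $ 1 = Complex ((w + y $ 3) / 2) 0"
  "herm w y $ 1 $ 2 = Complex (y $ 1 / 2) (- y $ 2 / 2)"
  "herm w y $ 2 $ 1 = Complex (y $ 1 / 2) (y $ 2 / 2)"
  "herm w y $ 2 $ 2 = Complex ((w - y $ 3) / 2) 0"
  by (simp_all add: herm_def bloch_op_def sum_3 pauli_def mat_def complex_eq_iff add_divide_distrib
      diff_divide_distrib)

lemma herm_inject: "herm w y = herm v x \<longleftrightarrow> w = v \<and> y = x"
proof
  assume eq: "herm w y = herm v x"
  from eq have "herm w y $ i $ j = herm v x $ i $ j" for i j by simp
  from this[of 1 1] this[of 2 2] this[of 1 2] show "w = v \<and> y = x"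
    by (simp add: herm_entries vec_eq_iff forall_3)
qed auto

lemma cinner_herm:
  "cinner v (herm w y *v v) = of_real ((w * (norm v)\<^sup>2 + y \<bullet> bloch_of v) / 2)"
proof -
  have "cinner v (herm w y *v v) = (of_real w * cinner v v + cinner v (bloch_op y *v v)) / 2"
    by (simp add: cinner_def herm_def matrix_vector_mult_def sum_2 mat_def
        scaleR_conv_of_real[where 'a=complex] field_simps)
  then show ?thesis
    by (simp add: cinner_self cinner_bloch_op)
qed

text \<open>The affine function is smallest on the sphere in the direction opposite to
  \<open>\<beta>\<close>, where its value is \<open>\<alpha> - norm \<beta>\<close>.\<close>

lemma norm_le_of_affine_nonneg:
  fixes \<beta> :: "real^3"
  assumes "\<And>x. norm x = 1 \<Longrightarrow> 0 \<le> \<alpha> + \<beta> \<bullet> x"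
  shows "norm \<beta> \<le> \<alpha>"
proof (cases "\<beta> = 0")
  case True
  then show ?thesis
    using assms[of "axis 1 1"] by simp
next
  case False
  then show ?thesis
    using assms[of "- (\<beta> /\<^sub>R norm \<beta>)"] by (simp add: dot_square_norm power2_eq_square field_simps)
qed

lemma psd_herm: "psd (herm w y) \<longleftrightarrow> norm y \<le> w"
proof
  assume psd: "psd (herm w y)"
  show "norm y \<le> w"
  proof (rule norm_le_of_affine_nonneg)
    fix x :: "real^3"
    assume "norm x = 1"
    then obtain v where "norm v = 1" "bloch_of v = x"
      using bloch_of_surj by blast
    moreover have "cinner v (herm w y *v v) \<in> \<real>\<^sub>\<ge>\<^sub>0"
      using psd by (simp add: psd_def)
    ultimately show "0 \<le> w + y \<bullet> x"
      unfolding cinner_herm nonneg_Reals_of_real_iff by simp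
  qed
next
  assume le: "norm y \<le> w"
  show "psd (herm w y)"
    unfolding psd_def
  proof
    fix v :: "complex^2"
    have "norm y * (norm v)\<^sup>2 \<le> w * (norm v)\<^sup>2"
      using le by (rule mult_right_mono) simp
    then have "0 \<le> w * (norm v)\<^sup>2 + y \<bullet> bloch_of v"
      using Cauchy_Schwarz_ineq2[of y "bloch_of v"] by (simp add: norm_bloch_of)
    then show "cinner v (herm w y *v v) \<in> \<real>\<^sub>\<ge>\<^sub>0"
      unfolding cinner_herm nonneg_Reals_of_real_iff by simp
  qed
qed

lemma psd_imp_herm:
  assumes "psd (M :: qop)"
  obtains w y where "M = herm w y"
proof -
  have im: "Im (cinner v (M *v v)) = 0" for v
    using assms by (auto simp: psd_def complex_nonneg_Reals_iff)
  have "M = herm (Re (M $ 1 $ 1) + Re (M $ 2 $ 2))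
     (vector [2 * Re (M $ 1 $ 2), - 2 * Im (M $ 1 $ 2), Re (M $ 1 $ 1) - Re (M $ 2 $ 2)])"
    \<comment> \<open>Real expectations at the first two vectors make the diagonal real; the other
      two make the off-diagonal entries conjugate to each other.\<close>
    using im[of "vector [1, 0]"] im[of "vector [0, 1]"] im[of "vector [1, 1]"] im[of "vector [1, \<i>]"]
    by (simp add: vec_eq_iff forall_2 herm_entries complex_eq_iff cinner_def matrix_vector_mult_def
        sum_2)
  then show ?thesis using that by blast
qed

lemma povm_herm:
  assumes "povm Ms"
  obtains w y where "\<And>i. i < length Ms \<Longrightarrow> Ms ! i = herm (w i) (y i) \<and> norm (y i) \<le> w i"
    "(\<Sum>i<length Ms. w i) = 2" "(\<Sum>i<length Ms. y i) = 0"
proof -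
  have "\<exists>w y. i < length Ms \<longrightarrow> Ms ! i = herm w y \<and> norm y \<le> w" for i
    using assms psd_imp_herm psd_herm unfolding povm_def by (metis nth_mem)
  then obtain w y where wy: "\<And>i. i < length Ms \<Longrightarrow> Ms ! i = herm (w i) (y i) \<and> norm (y i) \<le> w i"
    by metis
  have "herm 2 0 = (\<Sum>i<length Ms. Ms ! i)"
    using assms by (simp add: povm_def herm_2 sum_list_sum_nth atLeast0LessThan)
  also have "\<dots> = herm (\<Sum>i<length Ms. w i) (\<Sum>i<length Ms. y i)"
    using wy by (simp add: herm_sum[symmetric])
  finally show ?thesis
    using that wy unfolding herm_inject by metis
qed

section \<open>Positivity of the two-qubit state on product vectors\<close>

lemma sum_prod_UNIV:
  "(\<Sum>r\<in>(UNIV :: ('a::finite \<times> 'b::finite) set). f r) = (\<Sum>i\<in>UNIV. \<Sum>k\<in>UNIV. f (i, k))"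
  unfolding UNIV_Times_UNIV[symmetric] sum.cartesian_product by simp

definition tensor_vec :: "complex^2 \<Rightarrow> complex^2 \<Rightarrow> complex^(2 \<times> 2)" where
  "tensor_vec u v = (\<chi> r. u $ fst r * v $ snd r)"

lemma cinner_tensor:
  "cinner (tensor_vec u v) (tensor A B *v tensor_vec u v) = cinner u (A *v u) * cinner v (B *v v)"
  by (simp add: cinner_def tensor_vec_def tensor_def matrix_vector_mult_def sum_prod_UNIV sum_2
      algebra_simps)

lemma cinner_add_right: "cinner u (v + w) = cinner u v + cinner u w"
  by (simp add: cinner_def distrib_left sum.distrib)

lemma cinner_scaleR_right: "cinner u (c *\<^sub>R v) = c *\<^sub>R cinner u v"
  by (simp add: cinner_def scaleR_sum_right)

lemma cinner_sum_right: "cinner u (\<Sum>i\<in>I. f i) = (\<Sum>i\<in>I. cinner u (f i))"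
  by (simp add: cinner_def sum_component sum_distrib_left sum.swap[of _ I])

lemma scaleR_mv: "(c *\<^sub>R (A :: complex^'n^'m)) *v v = c *\<^sub>R (A *v v)"
  by (simp add: vec_eq_iff matrix_vector_mult_def scaleR_sum_right)

lemma sum_mv: "(\<Sum>i\<in>I. A i) *v v = (\<Sum>i\<in>I. A i *v (v :: complex^'n))"
  by (induction I rule: infinite_finite_induct) (simp_all add: matrix_vector_mult_add_rdistrib)

lemma bloch_op_axis: "bloch_op (axis i 1) = pauli $ i"
  by (simp add: bloch_op_def axis_def if_distrib[of "\<lambda>c. c *\<^sub>R _"] cong: if_cong)

lemma cinner_pauli: "cinner v (pauli $ i *v v) = of_real (bloch_of v $ i)"
  using cinner_bloch_op[of v "axis i 1"] by (simp add: bloch_op_axis inner_axis inner_commute)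

text \<open>Grouped as an affine function of Alice's Bloch vector, so that
  \<open>norm_le_of_affine_nonneg\<close> can be applied to it.\<close>

lemma cinner_two_qubit:
  assumes "norm u = 1" "norm v = 1"
  shows "cinner (tensor_vec u v) (two_qubit a b T *v tensor_vec u v) =
    of_real ((1 + b \<bullet> bloch_of v + (a + T *v bloch_of v) \<bullet> bloch_of u) / 4)"
proof -
  have "(\<Sum>i\<in>UNIV. \<Sum>j\<in>UNIV. T $ i $ j *\<^sub>R (of_real (x $ i) * of_real (s $ j))) =
      (of_real ((T *v s) \<bullet> x) :: complex)" for x s
    by (simp add: inner_vec_def matrix_vector_mult_def sum_distrib_left sum_distrib_right
        scaleR_conv_of_real mult_ac)
  then show ?thesis
    unfolding two_qubit_def scaleR_mv matrix_vector_mult_add_rdistrib sum_mv cinner_add_right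
      cinner_scaleR_right cinner_sum_right cinner_tensor cinner_pauli cinner_bloch_op
      matrix_vector_mul_lid
    using assms
    by (simp add: cinner_self inner_add_left scaleR_conv_of_real add_ac)
qed

text \<open>Positivity is tested on product vectors, with two applications of
  \<open>norm_le_of_affine_nonneg\<close>: minimising over Alice's direction bounds
  \<open>a + T *v s\<close>, and minimising over Bob's direction \<open>s\<close> then gives the
  claim.\<close>

lemma steered_positive:
  assumes "density_op (two_qubit a b T)" "norm y \<le> w"
  shows "norm (w *\<^sub>R b + transpose T *v y) \<le> w + a \<bullet> y"
proof (rule norm_le_of_affine_nonneg)
  fix s :: "real^3"
  assume "norm s = 1"
  then obtain v where v: "norm v = 1" "bloch_of v = s"
    using bloch_of_surj by blast
  have "norm (a + T *v s) \<le> 1 + b \<bullet> s"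
  proof (rule norm_le_of_affine_nonneg)
    fix x :: "real^3"
    assume "norm x = 1"
    then obtain u where u: "norm u = 1" "bloch_of u = x"
      using bloch_of_surj by blast
    have "cinner (tensor_vec u v) (two_qubit a b T *v tensor_vec u v) \<in> \<real>\<^sub>\<ge>\<^sub>0"
      using assms(1) by (auto simp: density_op_def psd_def)
    then show "0 \<le> 1 + b \<bullet> s + (a + T *v s) \<bullet> x"
      unfolding cinner_two_qubit[OF u(1) v(1)] u v nonneg_Reals_of_real_iff by simp
  qed
  then have "norm y * norm (a + T *v s) \<le> w * (1 + b \<bullet> s)"
    using assms(2) by (intro mult_mono) (auto intro: order_trans[OF norm_ge_zero])
  moreover have "\<bar>y \<bullet> (a + T *v s)\<bar> \<le> norm y * norm (a + T *v s)"
    by (rule Cauchy_Schwarz_ineq2)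
  moreover have "(transpose T *v y) \<bullet> s = y \<bullet> (T *v s)"
    by (simp add: dot_lmul_matrix transpose_matrix_vector)
  ultimately show "0 \<le> w + a \<bullet> y + (w *\<^sub>R b + transpose T *v y) \<bullet> s"
    by (simp add: inner_add inner_commute algebra_simps)
qed

section \<open>Partial traces and outcome probabilities\<close>

lemma ptrace_A_tensor:
  assumes "trace (M ** A) = of_real c"
  shows "ptrace_A (tensor M (mat 1) ** tensor A B) = c *\<^sub>R B"
proof -
  have "c *\<^sub>R z = trace (M ** A) * z" for z :: complex
    by (simp add: assms scaleR_conv_of_real)
  then show ?thesis
    by (simp add: vec_eq_iff forall_2 ptrace_A_def tensor_def matrix_matrix_mult_def sum_prod_UNIV
        sum_2 mat_def trace_def algebra_simps)
qed

lemma ptrace_A_add: "ptrace_A (M ** (X + Y)) = ptrace_A (M ** X) + ptrace_A (M ** Y)"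
  by (simp add: vec_eq_iff ptrace_A_def matrix_add_ldistrib sum.distrib)

lemma ptrace_A_scaleR: "ptrace_A (M ** (c *\<^sub>R X)) = c *\<^sub>R ptrace_A (M ** X)"
  by (simp add: vec_eq_iff ptrace_A_def matrix_matrix_mult_def scaleR_sum_right)

lemma ptrace_A_sum: "ptrace_A (M ** (\<Sum>i\<in>I. X i)) = (\<Sum>i\<in>I. ptrace_A (M ** X i))"
proof (induction I rule: infinite_finite_induct)
  case (insert x F)
  then show ?case by (simp add: ptrace_A_add)
qed (simp_all add: vec_eq_iff ptrace_A_def matrix_matrix_mult_def)

lemma trace_herm:
  "trace (herm w y ** mat 1) = of_real w"
  "trace (herm w y ** bloch_op x) = of_real (x \<bullet> y)"
  "trace (herm w y ** pauli $ i) = of_real (y $ i)"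
proof -
  show "trace (herm w y ** mat 1) = of_real w"
    by (simp add: trace_def sum_2 herm_entries complex_eq_iff add_divide_distrib diff_divide_distrib)
  have bloch: "trace (herm w y ** bloch_op x) = of_real (x \<bullet> y)" for x
    by (simp add: trace_def sum_2 herm_entries complex_eq_iff matrix_matrix_mult_def bloch_op_def
        sum_3 pauli_def inner_vec_def field_simps)
  then show "trace (herm w y ** bloch_op x) = of_real (x \<bullet> y)" .
  show "trace (herm w y ** pauli $ i) = of_real (y $ i)"
    using bloch[of "axis i 1"] by (simp add: bloch_op_axis inner_axis inner_commute)
qed

text \<open>Traces against the effect pick out its coordinates. Contracting Alice's index of
  \<open>T\<close> is what produces the transpose.\<close>

lemma ptrace_A_steered:
  "ptrace_A (tensor (herm w y) (mat 1) ** two_qubit a b T) =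
     herm ((w + a \<bullet> y) / 2) ((1/2) *\<^sub>R (w *\<^sub>R b + transpose T *v y))"
proof -
  have "(\<Sum>i\<in>UNIV. \<Sum>j\<in>UNIV. T $ i $ j *\<^sub>R y $ i *\<^sub>R pauli $ j) = bloch_op (transpose T *v y)"
    unfolding bloch_op_def matrix_vector_mult_def transpose_def
    by (subst sum.swap) (simp add: scaleR_sum_left)
  then show ?thesis
    unfolding two_qubit_def ptrace_A_add ptrace_A_scaleR ptrace_A_sum
      trace_herm[THEN ptrace_A_tensor]
    by (simp add: herm_def bloch_op_add bloch_op_scaleR scaleR_add_left scaleR_add_right
        add_divide_distrib add_ac)
qed

lemma trace_ptrace_A: "trace (ptrace_A X) = trace X"
  unfolding trace_def ptrace_A_def sum_prod_UNIV by (subst sum.swap) simp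

lemma outcome_prob_herm: "outcome_prob (two_qubit a b T) (herm w y) = (w + a \<bullet> y) / 2"
  unfolding outcome_prob_def trace_ptrace_A[symmetric] ptrace_A_steered
  by (simp add: trace_def sum_2 herm_entries add_divide_distrib diff_divide_distrib)

section \<open>Attainment of the maximum over POVMs\<close>

text \<open>By homogeneity, a POVM average of \<open>F\<close> is twice the height of a convex
  combination of points on the graph of \<open>G\<close> whose base points average to 0. The largest
  height is found by compactness, and a finite convex combination reaching it is converted back into
  a POVM.\<close>

lemma povm_max_attained:
  assumes cont: "continuous_on (cball 0 1) G"
    and hom: "\<And>w x. 0 \<le> w \<Longrightarrow> norm x \<le> 1 \<Longrightarrow> F (herm w (w *\<^sub>R x)) = w * (G x :: real)"
  obtains Ms where "povm Ms" "\<And>Ms'. povm Ms' \<Longrightarrow> (\<Sum>M\<leftarrow>Ms'. F M) \<le> (\<Sum>M\<leftarrow>Ms. F M)"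
proof -
  define K where "K = (\<lambda>x. (x, G x)) ` cball 0 1"
  have "compact K"
    unfolding K_def using cont by (intro compact_continuous_image continuous_intros) auto
  then have "compact (convex hull K \<inter> {0} \<times> UNIV)"
    by (intro compact_Int_closed compact_convex_hull closed_Times) auto
  moreover have "(0, G 0) \<in> convex hull K"
    unfolding K_def by (intro hull_inc) auto
  then have "convex hull K \<inter> {0} \<times> UNIV \<noteq> {}"
    by blast
  ultimately obtain p where p: "p \<in> convex hull K \<inter> {0} \<times> UNIV"
      "\<And>q. q \<in> convex hull K \<inter> {0} \<times> UNIV \<Longrightarrow> snd q \<le> snd p"
    using continuous_attains_sup[of _ snd] continuous_on_snd[OF continuous_on_id] by metis
  define t where "t = snd p"
  have t: "(0, t) \<in> convex hull K" "\<And>t'. (0, t') \<in> convex hull K \<Longrightarrow> t' \<le> t"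
    using p unfolding t_def by force+
  obtain S u where S: "finite S" "S \<subseteq> K" and u: "\<forall>v\<in>S. 0 \<le> u v" "sum u S = 1"
    and bary: "(\<Sum>v\<in>S. u v *\<^sub>R v) = (0, t)"
    using t(1) unfolding convex_hull_explicit by blast
  obtain vs where vs: "set vs = S" "distinct vs"
    using finite_distinct_list[OF S(1)] by blast
  have K: "norm (fst v) \<le> 1" "snd v = G (fst v)" if "v \<in> S" for v
    using that S(2) by (auto simp: K_def)
  have bary_fst: "(\<Sum>v\<in>S. u v *\<^sub>R fst v) = 0" and bary_snd: "(\<Sum>v\<in>S. u v * snd v) = t"
    using arg_cong[OF bary, of fst] arg_cong[OF bary, of snd]
    by (simp_all add: fst_sum snd_sum)
  \<comment> \<open>The factor 2 is the trace of the identity: the convex weights sum to 1, the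
    traces of the effects to 2.\<close>
  define Ms where "Ms = map (\<lambda>v. herm (2 * u v) ((2 * u v) *\<^sub>R fst v)) vs"
  show ?thesis
  proof (rule that)
    have "sum_list Ms = (\<Sum>v\<in>S. herm (2 * u v) (2 *\<^sub>R u v *\<^sub>R fst v))"
      using vs by (simp add: Ms_def sum_list_distinct_conv_sum_set)
    also have "\<dots> = mat 1"
      unfolding herm_sum sum_distrib_left[symmetric] scaleR_sum_right[symmetric]
      by (simp add: u(2) bary_fst herm_2)
    finally have "sum_list Ms = mat 1" .
    moreover have "psd M" if "M \<in> set Ms" for M
      using that vs(1) K(1) u(1) by (auto simp: Ms_def psd_herm mult_left_le)
    ultimately show "povm Ms"
      by (simp add: povm_def)
    have "(\<Sum>M\<leftarrow>Ms. F M) = (\<Sum>v\<in>S. F (herm (2 * u v) ((2 * u v) *\<^sub>R fst v)))"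
      using vs by (simp add: Ms_def sum_list_distinct_conv_sum_set comp_def)
    also have "\<dots> = (\<Sum>v\<in>S. 2 * (u v * snd v))"
      using K u(1) by (intro sum.cong refl) (subst hom; simp)
    also have "\<dots> = 2 * t"
      by (simp add: sum_distrib_left[symmetric] bary_snd)
    finally have Ms: "(\<Sum>M\<leftarrow>Ms. F M) = 2 * t" .
    fix Ms'
    assume "povm Ms'"
    then obtain w y where wy: "\<And>i. i < length Ms' \<Longrightarrow> Ms' ! i = herm (w i) (y i) \<and> norm (y i) \<le> w i"
      and sums: "(\<Sum>i<length Ms'. w i) = 2" "(\<Sum>i<length Ms'. y i) = 0"
      using povm_herm by blast
    \<comment> \<open>If \<open>w i = 0\<close> then \<open>y i = 0\<close> as well, and division by
      zero yields \<open>x i = 0\<close>, so \<open>w i *\<^sub>R x i = y i\<close> holds in this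
      case too.\<close>
    define x where "x i = (1 / w i) *\<^sub>R y i" for i
    have w0: "0 \<le> w i" and wx: "w i *\<^sub>R x i = y i" and x1: "norm (x i) \<le> 1"
      if "i < length Ms'" for i
    proof -
      have *: "norm (y i) \<le> w i" using wy[OF that] by blast
      then show "0 \<le> w i" by (rule order_trans[OF norm_ge_zero])
      with * show "w i *\<^sub>R x i = y i" "norm (x i) \<le> 1"
        by (cases "w i = 0"; simp add: x_def)+
    qed
    \<comment> \<open>The weights \<open>w i / 2\<close> sum to 1, so this is a convex combination
      of points of \<open>K\<close>; completeness of the POVM puts it over 0.\<close>
    have "(\<Sum>i<length Ms'. (w i / 2) *\<^sub>R (x i, G (x i))) \<in> convex hull K"
      using w0 x1 sums(1) unfolding K_def
      by (intro convex_sum) (auto simp: sum_divide_distrib[symmetric] intro!: hull_inc)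
    also have "(\<Sum>i<length Ms'. (w i / 2) *\<^sub>R (x i, G (x i))) =
        ((1/2) *\<^sub>R (\<Sum>i<length Ms'. w i *\<^sub>R x i), (\<Sum>i<length Ms'. w i * G (x i)) / 2)"
      by (simp add: prod_eq_iff fst_sum snd_sum scaleR_sum_right sum_divide_distrib)
    also have "(\<Sum>i<length Ms'. w i *\<^sub>R x i) = 0"
      using wx sums(2) by simp
    finally have "(0, (\<Sum>i<length Ms'. w i * G (x i)) / 2) \<in> convex hull K"
      by simp
    then have "(\<Sum>i<length Ms'. w i * G (x i)) / 2 \<le> t"
      by (rule t(2))
    moreover have "(\<Sum>M\<leftarrow>Ms'. F M) = (\<Sum>i<length Ms'. w i * G (x i))"
    proof -
      have "(\<Sum>M\<leftarrow>Ms'. F M) = (\<Sum>i<length Ms'. F (Ms' ! i))"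
        by (simp add: sum_list_sum_nth atLeast0LessThan)
      also have "\<dots> = (\<Sum>i<length Ms'. w i * G (x i))"
        using wy wx w0 x1 hom by (intro sum.cong refl) (metis lessThan_iff)
      finally show ?thesis .
    qed
    ultimately show "(\<Sum>M\<leftarrow>Ms'. F M) \<le> (\<Sum>M\<leftarrow>Ms. F M)"
      using Ms by simp
  qed
qed

section \<open>The contribution of a single outcome\<close>

text \<open>The contribution of an outcome to the steered average, written homogeneously in the effect:
  the division by the outcome probability cancels, which gives continuity at outcomes of
  probability zero.\<close>

definition steered :: "real^3 \<Rightarrow> real^3 \<Rightarrow> real^3 \<Rightarrow> real^3^3 \<Rightarrow> real \<Rightarrow> real^3 \<Rightarrow> real" where
  "steered n a b T w y =
    (norm (w *\<^sub>R b + transpose T *v y + (w + a \<bullet> y) *\<^sub>R n)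
      + norm (w *\<^sub>R b + transpose T *v y - (w + a \<bullet> y) *\<^sub>R n)) / 8 - (w + a \<bullet> y) / 4"

lemma steered_scale:
  assumes "0 \<le> c"
  shows "steered n a b T (c * w) (c *\<^sub>R y) = c * steered n a b T w y"
proof -
  have "(c * w) *\<^sub>R b + transpose T *v (c *\<^sub>R y) + (c * w + a \<bullet> (c *\<^sub>R y)) *\<^sub>R v =
      c *\<^sub>R (w *\<^sub>R b + transpose T *v y + (w + a \<bullet> y) *\<^sub>R v)" for v
    by (simp add: matrix_vector_mult_scaleR algebra_simps)
  then have "norm ((c * w) *\<^sub>R b + transpose T *v (c *\<^sub>R y) + (c * w + a \<bullet> (c *\<^sub>R y)) *\<^sub>R v) =
      c * norm (w *\<^sub>R b + transpose T *v y + (w + a \<bullet> y) *\<^sub>R v)" for v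
    using assms by simp
  from this[of n] this[of "- n"] show ?thesis
    unfolding scaleR_minus_right add_uminus_conv_diff steered_def
    by (simp only:) (simp add: field_simps)
qed

lemma continuous_on_steered: "continuous_on A (steered n a b T w)"
proof -
  have "continuous_on A (\<lambda>y. transpose T *v y)"
    by (rule linear_continuous_on[OF matrix_vector_mul_bounded_linear])
  then show ?thesis
    unfolding steered_def[abs_def] by (intro continuous_intros) simp_all
qed

lemma Sigma_KD_norm:
  assumes "norm n = 1"
  shows "Sigma_KD (r_par n r) (r_perp n r) = (norm (r + n) + norm (r - n)) / 4"
  using norm_reference_add[OF assms, of 0 r] norm_reference_add[OF assms, of 1 r]
  by (simp add: Sigma_KD_def add.commute)

text \<open>Multiplying by the probability \<open>q / 2\<close> clears the division inside both
  norms and turns the constant -1/2 into \<open>- q / 4\<close>.\<close>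

lemma steered_eq:
  assumes "norm n = 1" "density_op (two_qubit a b T)" "norm y \<le> w"
  shows "(w + a \<bullet> y) / 2 * N_KD n (qubit_state ((1 / (w + a \<bullet> y)) *\<^sub>R (w *\<^sub>R b + transpose T *v y)))
    = steered n a b T w y"
proof -
  define q where "q = w + a \<bullet> y"
  define z where "z = w *\<^sub>R b + transpose T *v y"
  have z: "norm z \<le> q"
    unfolding q_def z_def by (rule steered_positive[OF assms(2,3)])
  have "q / 2 * N_KD n (qubit_state ((1 / q) *\<^sub>R z)) = (norm (z + q *\<^sub>R n) + norm (z - q *\<^sub>R n)) / 8 - q / 4"
  proof (cases "q = 0")
    \<comment> \<open>Positivity of the state forces \<open>z = 0\<close> here, so the right-hand
      side vanishes along with the probability.\<close>
    case True
    then show ?thesis using z by simp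
  next
    case False
    with z have q: "q > 0"
      using norm_ge_zero[of z] by linarith
    have "norm (z + q *\<^sub>R v) = q * norm ((1 / q) *\<^sub>R z + v)" for v
    proof -
      have "z + q *\<^sub>R v = q *\<^sub>R ((1 / q) *\<^sub>R z + v)"
        using q by (simp add: scaleR_add_right)
      then show ?thesis using q by simp
    qed
    from this[of n] this[of "- n"] show ?thesis
      by (simp add: N_KD_qubit_state Sigma_KD_norm assms(1) field_simps)
  qed
  then show ?thesis
    by (simp add: steered_def q_def z_def)
qed

lemma outcome_eq_steered:
  assumes "norm n = 1" "density_op (two_qubit a b T)" "norm y \<le> w"
  shows "outcome_prob (two_qubit a b T) (herm w y) * N_KD n (cond_state (two_qubit a b T) (herm w y))
    = steered n a b T w y"
proof (cases "w + a \<bullet> y = 0")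
  \<comment> \<open>The conditional state involves a division by zero, but its weight is
    zero.\<close>
  case True
  then show ?thesis
    using steered_eq[OF assms] by (simp add: outcome_prob_herm)
next
  case False
  have "(1 / (q / 2)) *\<^sub>R herm (q / 2) ((1/2) *\<^sub>R z) = qubit_state ((1 / q) *\<^sub>R z)"
    if "q \<noteq> 0" for q z
    using that by (simp add: herm_scaleR qubit_state_herm)
  then have "cond_state (two_qubit a b T) (herm w y) =
      qubit_state ((1 / (w + a \<bullet> y)) *\<^sub>R (w *\<^sub>R b + transpose T *v y))"
    unfolding cond_state_def outcome_prob_herm ptrace_A_steered using False by blast
  then show ?thesis
    using steered_eq[OF assms] by (simp add: outcome_prob_herm)
qed

section \<open>Evaluation and comparison of the two steered averages\<close>

theorem theorem6:
  fixes a b nB :: "real^3" and T :: "real^3^3" and \<rho> :: qop2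
  assumes "density_op \<rho>" and "\<rho> = two_qubit a b T"
    and "b \<noteq> 0" and "nB = (1 / norm b) *\<^sub>R b"
  shows "C_KD2 nB a b T =
           max_over
             (\<lambda>m. steer_prob a m *
                    Sigma_KD (r_par nB (steer_bloch a b T m)) (r_perp nB (steer_bloch a b T m))
                + steer_prob a (- m) *
                    Sigma_KD (r_par nB (steer_bloch a b T (- m))) (r_perp nB (steer_bloch a b T (- m))))
             {m. norm m = 1} - 1/2
         \<and> C_KD2 nB a b T \<le> C_KD nB \<rho>"
proof -
  have n: "norm nB = 1"
    using assms by simp
  have dens: "density_op (two_qubit a b T)"
    using assms by simp
  define g where "g = steered nB a b T 1"
  have N: "steer_prob a m * N_KD nB (qubit_state (steer_bloch a b T m)) = g m" if "norm m = 1" for m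
    using steered_eq[OF n dens, of m 1] that by (simp add: g_def steer_prob_def steer_bloch_def)
  have Sigma: "steer_prob a m *
      Sigma_KD (r_par nB (steer_bloch a b T m)) (r_perp nB (steer_bloch a b T m)) =
      g m + steer_prob a m / 2" if "norm m = 1" for m
    using N[OF that] unfolding N_KD_qubit_state[OF n] by (simp add: right_diff_distrib)
  have sum1: "steer_prob a m + steer_prob a (- m) = 1" for m
    by (simp add: steer_prob_def field_simps)
  have g: "continuous_on A g" for A
    unfolding g_def by (rule continuous_on_steered)
  have "continuous_on (sphere 0 1) (\<lambda>m. g m + g (- m))"
    by (intro continuous_on_add g continuous_on_compose2[OF g[of UNIV]] continuous_intros) auto
  then obtain m0 where m0: "norm m0 = 1" "\<And>m. norm m = 1 \<Longrightarrow> g m + g (- m) \<le> g m0 + g (- m0)"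
    using continuous_attains_sup[of "sphere 0 1" "\<lambda>m. g m + g (- m)"] by auto
  have C2: "C_KD2 nB a b T = g m0 + g (- m0)"
    unfolding C_KD2_def by (subst max_over_eq[of m0]) (use m0 in \<open>simp_all add: N\<close>)
  have "max_over
      (\<lambda>m. steer_prob a m *
             Sigma_KD (r_par nB (steer_bloch a b T m)) (r_perp nB (steer_bloch a b T m))
         + steer_prob a (- m) *
             Sigma_KD (r_par nB (steer_bloch a b T (- m))) (r_perp nB (steer_bloch a b T (- m))))
      {m. norm m = 1} = g m0 + g (- m0) + 1/2"
    (is "max_over ?f _ = _")
  proof -
    \<comment> \<open>The two corrections \<open>steer_prob a m / 2\<close> and
      \<open>steer_prob a (- m) / 2\<close> add up to the constant 1/2, so both objectives are
      maximised at the same \<open>m0\<close>.\<close>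
    have f: "?f m = g m + g (- m) + 1/2" if "norm m = 1" for m
      using that Sigma[of m] Sigma[of "- m"] sum1[of m] by simp
    then show ?thesis
      using m0 by (subst max_over_eq[of m0]) simp_all
  qed
  moreover have "C_KD2 nB a b T \<le> C_KD nB \<rho>"
  proof -
    define F where "F M = outcome_prob \<rho> M * N_KD nB (cond_state \<rho> M)" for M
    have F: "F (herm w y) = steered nB a b T w y" if "norm y \<le> w" for w y
      using outcome_eq_steered[OF n dens that] by (simp add: F_def assms(2))
    have hom: "F (herm w (w *\<^sub>R x)) = w * g x" if "0 \<le> w" "norm x \<le> 1" for w x
      using that steered_scale[of w nB a b T 1 x] F[of "w *\<^sub>R x" w]
      by (simp add: g_def mult_left_le)
    obtain Ms where Ms: "povm Ms" "\<And>Ms'. povm Ms' \<Longrightarrow> (\<Sum>M\<leftarrow>Ms'. F M) \<le> (\<Sum>M\<leftarrow>Ms. F M)"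
      using povm_max_attained[OF g hom] by blast
    have "C_KD nB \<rho> = (\<Sum>M\<leftarrow>Ms. F M)"
      unfolding C_KD_def F_def[symmetric] by (rule max_over_eq) (use Ms in auto)
    \<comment> \<open>The optimal dichotomic measurement is itself a competitor in the maximum over
      POVMs.\<close>
    moreover have "povm [herm 1 m0, herm 1 (- m0)]"
      using m0(1) by (simp add: povm_def psd_herm herm_add herm_2)
    then have "F (herm 1 m0) + F (herm 1 (- m0)) \<le> (\<Sum>M\<leftarrow>Ms. F M)"
      using Ms(2) by fastforce
    ultimately show ?thesis
      using C2 F m0(1) by (simp add: g_def)
  qed
  ultimately show ?thesis
    using C2 by simp
qed

end
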